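(* Let $\mathrm{d}$ be a diffuse Fredholm-nilpotent operator on a real Hilbert space $W$ with dense domain $V$, and let $V_h\subset V$ be a family of closed subspaces, parametrized by $h$, with $\mathrm{d}V_h\subset V_h$, equipped with projections $\pi_h$ onto $V_h$ that are defined and bounded on $W$, uniformly in $h$, and satisfy $\pi_h\mathrm{d}=\mathrm{d}\pi_h$ on $V$. Then there is a constant $C>0$, independent of $h$ and $f$, such that for every $f\in W$ and every $h$: if $(u,p)\in V\times\mathfrak{H}$ solves $$\langle \mathrm{d}u,v\rangle+\langle u,\mathrm{d}v\rangle+\langle p,v\rangle=\langle f,v\rangle\ \ \forall v\in V,\qquad \langle u,q\rangle=0\ \ \forall q\in\mathfrak{H},$$ and $(u_h,p_h)\in V_h\times\mathfrak{H}_h$ solves $$\langle \mathrm{d}u_h,v_h\rangle+\langle u_h,\mathrm{d}v_h\rangle+\langle p_h,v_h\rangle=\langle f,v_h\rangle\ \ \forall v_h\in V_h,\qquad \langle u_h,q_h\rangle=0\ \ \forall q_h\in\mathfrak{H}_h,$$ then $$\|p-p_h\|\le C\bigl[E(p)+\mu\,E(\mathrm{d}u)\bigr],$$ where $\mu=\|(I-\pi_h)P_{\mathfrak{H}}\|$.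
   Context: $W$ has inner product $\langle\cdot,\cdot\rangle$ and norm $\|\cdot\|$. A closed, densely defined linear operator $\mathrm{d}$ on $W$ with domain $V=\mathcal{D}(\mathrm{d})$ is nilpotent if its range is contained in its kernel (so $\mathrm{d}^2=0$); it is diffuse Fredholm-nilpotent if in addition its range is closed, its range has finite codimension in its kernel, and $\mathcal{D}(\mathrm{d})\cap\ker(\mathrm{d})^\perp$ (with the graph norm) is compactly included in $\ker(\mathrm{d})^\perp$. $V$ carries the graph inner product $\langle u,v\rangle_V=\langle u,v\rangle+\langle \mathrm{d}u,\mathrm{d}v\rangle$. Set $\mathfrak{Z}=\ker\mathrm{d}$, $\mathfrak{B}=\operatorname{range}\mathrm{d}$, $\mathfrak{H}=\mathfrak{Z}\cap\mathfrak{B}^{\perp_W}$, where $\perp_W$ is the orthogonal complement in $W$. "Projection $\pi_h$ onto $V_h$" means linear, idempotent, with range $V_h$ (not necessarily orthogonal). For $\mathrm{d}_h=\mathrm{d}|_{V_h}$ put $\mathfrak{Z}_h=\ker\mathrm{d}_h$, $\mathfrak{B}_h=\mathrm{d}V_h$, $\mathfrak{H}_h=\{z\in\mathfrak{Z}_h:\langle z,b\rangle=0\ \forall b\in\mathfrak{B}_h\}$. $P_{\mathfrak{H}}$ denotes $W$-orthogonal projection onto $\mathfrak{H}$, and $\mu$ (which depends on $h$) is an operator norm on $W$. For $w\in W$, $E(w)=\inf_{v_h\in V_h}\|w-v_h\|$. *)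

theory Defs
  imports "HOL-Analysis.Analysis"
begin

text \<open>
  A Hilbert space is a type of class \<open>{real_inner, complete_space}\<close>.  An unbounded operator is
  a pair of a domain \<open>V\<close> and a function \<open>d\<close> whose values outside \<open>V\<close> are irrelevant, so
  that the restriction of \<open>d\<close> to a subspace \<open>U\<close> of \<open>V\<close> is the pair of \<open>U\<close> and \<open>d\<close>.
\<close>

definition linear_operator_on :: "'a::real_vector set \<Rightarrow> ('a \<Rightarrow> 'a) \<Rightarrow> bool" where
  "linear_operator_on V d \<longleftrightarrow>
     subspace V \<and>
     (\<forall>u\<in>V. \<forall>v\<in>V. d (u + v) = d u + d v) \<and>
     (\<forall>c. \<forall>u\<in>V. d (c *\<^sub>R u) = c *\<^sub>R d u)"

definition closed_densely_defined :: "'a::real_normed_vector set \<Rightarrow> ('a \<Rightarrow> 'a) \<Rightarrow> bool" where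
  "closed_densely_defined V d \<longleftrightarrow>
     linear_operator_on V d \<and> closure V = UNIV \<and> closed ((\<lambda>u. (u, d u)) ` V)"

definition op_kernel :: "'a set \<Rightarrow> ('a::real_vector \<Rightarrow> 'a) \<Rightarrow> 'a set" where
  "op_kernel V d = {u \<in> V. d u = 0}"

definition nilpotent_operator :: "'a::real_normed_vector set \<Rightarrow> ('a \<Rightarrow> 'a) \<Rightarrow> bool" where
  "nilpotent_operator V d \<longleftrightarrow> closed_densely_defined V d \<and> d ` V \<subseteq> op_kernel V d"

text \<open>The quotient of \<open>Z\<close> by \<open>R\<close> is spanned by the cosets of finitely many elements of \<open>Z\<close>.\<close>

definition finite_codim_in :: "'a::real_vector set \<Rightarrow> 'a set \<Rightarrow> bool" where
  "finite_codim_in R Z \<longleftrightarrow> R \<subseteq> Z \<and> (\<exists>F. finite F \<and> F \<subseteq> Z \<and> Z = span (R \<union> F))"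

definition graph_norm :: "('a::real_inner \<Rightarrow> 'a) \<Rightarrow> 'a \<Rightarrow> real" where
  "graph_norm d u = sqrt (inner u u + inner (d u) (d u))"

text \<open>
  Sets bounded in the graph norm are relatively compact in the norm of the ambient space.  If \<open>U\<close>
  lies in a closed subspace, such as an orthogonal complement, the closure may equivalently be taken
  in that subspace.
\<close>

definition graph_compactly_included :: "'a::real_inner set \<Rightarrow> ('a \<Rightarrow> 'a) \<Rightarrow> bool" where
  "graph_compactly_included U d \<longleftrightarrow>
     (\<forall>B. B \<subseteq> U \<and> (\<exists>K. \<forall>u\<in>B. graph_norm d u \<le> K) \<longrightarrow> compact (closure B))"

definition diffuse_fredholm_nilpotent ::
    "'a::{real_inner, complete_space} set \<Rightarrow> ('a \<Rightarrow> 'a) \<Rightarrow> bool" where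
  "diffuse_fredholm_nilpotent V d \<longleftrightarrow>
     nilpotent_operator V d \<and>
     closed (d ` V) \<and>
     finite_codim_in (d ` V) (op_kernel V d) \<and>
     graph_compactly_included (V \<inter> (op_kernel V d)\<^sup>\<bottom>) d"

text \<open>
  With \<open>U = V\<close> this is the space of harmonic vectors of \<open>d\<close>; with \<open>U\<close> a subspace
  \<open>V\<^sub>h\<close> invariant under \<open>d\<close> it is the space of discrete harmonic vectors.
\<close>

definition harmonic :: "'a::real_inner set \<Rightarrow> ('a \<Rightarrow> 'a) \<Rightarrow> 'a set" where
  "harmonic U d = op_kernel U d \<inter> (d ` U)\<^sup>\<bottom>"

definition projection_onto :: "'a::real_vector set \<Rightarrow> ('a \<Rightarrow> 'a) \<Rightarrow> bool" where
  "projection_onto S P \<longleftrightarrow> linear P \<and> (\<forall>w. P (P w) = P w) \<and> range P = S"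

text \<open>Well defined on all of a Hilbert space whenever \<open>S\<close> is a closed subspace.\<close>

definition orth_proj :: "'a::real_inner set \<Rightarrow> 'a \<Rightarrow> 'a" where
  "orth_proj S w = (THE y. y \<in> S \<and> w - y \<in> S\<^sup>\<bottom>)"

definition best_error :: "'a::real_normed_vector set \<Rightarrow> 'a \<Rightarrow> real" where
  "best_error U w = (INF v\<in>U. norm (w - v))"

text \<open>Continuous problem for \<open>U = V\<close>, discrete problem for \<open>U = V\<^sub>h\<close>.\<close>

definition solves_hodge_dirac ::
    "'a::real_inner set \<Rightarrow> ('a \<Rightarrow> 'a) \<Rightarrow> 'a \<Rightarrow> 'a \<Rightarrow> 'a \<Rightarrow> bool" where
  "solves_hodge_dirac U d f u p \<longleftrightarrow>
     u \<in> U \<and> p \<in> harmonic U d \<and>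
     (\<forall>v\<in>U. inner (d u) v + inner u (d v) + inner p v = inner f v) \<and>
     (\<forall>q\<in>harmonic U d. inner u q = 0)"

end

theory Submission
  imports Defs
begin

text \<open>
  Testing the two problems with cycles gives \<open>\<langle>p\<^sub>h, q\<rangle> = \<langle>d u + p, q\<rangle>\<close> for every discrete harmonic
  \<open>q\<close>.  The contribution of \<open>p\<close> is quasi-optimal because \<open>p\<close> is orthogonal to the
  discrete boundaries.  In the contribution \<open>\<langle>d u, q\<rangle>\<close>, orthogonality of \<open>q\<close> to the discrete
  boundaries allows \<open>d u\<close> to be replaced by the boundary \<open>d u - \<pi>\<^sub>h (d u)\<close>, which sees only
  \<open>q - P q\<close>, with \<open>P\<close> the projection onto the harmonic space.  Finally \<open>q - \<pi>\<^sub>h (P q)\<close> is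
  a discrete boundary, so that \<open>\<parallel>q - P q\<parallel> \<le> \<parallel>(I - \<pi>\<^sub>h) P q\<parallel> \<le> \<mu> \<parallel>q\<parallel>\<close>.
\<close>

section \<open>Orthogonal complements and closures of subspaces\<close>

lemma orthogonal_comp_iff: "x \<in> S\<^sup>\<bottom> \<longleftrightarrow> (\<forall>y\<in>S. inner x y = 0)"
  by (auto simp: orthogonal_comp_def orthogonal_def inner_commute)

lemma closed_orthogonal_comp: "closed (S\<^sup>\<bottom>)"
proof -
  have "S\<^sup>\<bottom> = (\<Inter>y\<in>S. {x. inner y x = 0})"
    by (auto simp: orthogonal_comp_def orthogonal_def)
  then show ?thesis
    by (auto intro!: closed_INT closed_Collect_eq continuous_intros)
qed

text \<open>The double complement of \<open>S\<close> is closed and contains \<open>S\<close>, so it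
  contains \<open>closure S\<close>; symmetry of the inner product then gives the nontrivial
  inclusion.\<close>

lemma orthogonal_comp_closure: "(closure S)\<^sup>\<bottom> = S\<^sup>\<bottom>"
proof
  show "(closure S)\<^sup>\<bottom> \<subseteq> S\<^sup>\<bottom>"
    by (simp add: orthogonal_comp_anti_mono closure_subset)
  have "closure S \<subseteq> (S\<^sup>\<bottom>)\<^sup>\<bottom>"
    by (intro closure_minimal orthogonal_comp_subset closed_orthogonal_comp)
  then show "S\<^sup>\<bottom> \<subseteq> (closure S)\<^sup>\<bottom>"
    unfolding subset_iff orthogonal_comp_iff[of _ "closure S"] orthogonal_comp_iff[of _ "S\<^sup>\<bottom>"]
    by (metis inner_commute)
qed

lemma subspace_closure:
  fixes S :: "'a::real_normed_vector set"
  assumes S: "subspace S"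
  shows "subspace (closure S)"
proof (rule subspaceI)
  show "0 \<in> closure S"
    using subspace_0[OF S] closure_subset by blast
next
  fix x y assume "x \<in> closure S" "y \<in> closure S"
  then obtain a b where "\<forall>n. a n \<in> S" "a \<longlonglongrightarrow> x" "\<forall>n. b n \<in> S" "b \<longlonglongrightarrow> y"
    unfolding closure_sequential by blast
  then have "\<forall>n. a n + b n \<in> S" "(\<lambda>n. a n + b n) \<longlonglongrightarrow> x + y"
    using subspace_add[OF S] by (auto intro: tendsto_add)
  then show "x + y \<in> closure S"
    unfolding closure_sequential by (intro exI[of _ "\<lambda>n. a n + b n"] conjI)
next
  fix c x assume "x \<in> closure S"
  then obtain a where "\<forall>n. a n \<in> S" "a \<longlonglongrightarrow> x"
    unfolding closure_sequential by blast
  then have "\<forall>n. c *\<^sub>R a n \<in> S" "(\<lambda>n. c *\<^sub>R a n) \<longlonglongrightarrow> c *\<^sub>R x"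
    using subspace_scale[OF S] by (auto intro: tendsto_scaleR)
  then show "c *\<^sub>R x \<in> closure S"
    unfolding closure_sequential by (intro exI[of _ "\<lambda>n. c *\<^sub>R a n"] conjI)
qed

section \<open>Orthogonal projection onto closed subspaces\<close>

text \<open>A minimizing sequence is Cauchy by the parallelogram law, because midpoints of its
  members stay in \<open>S\<close>; completeness and closedness put its limit in
  \<open>S\<close>.\<close>

lemma subspace_nearest_point_exists:
  fixes S :: "'a::{real_inner, complete_space} set"
  assumes S: "subspace S" "closed S"
  shows "\<exists>y\<in>S. \<forall>s\<in>S. norm (w - y) \<le> norm (w - s)"
proof -
  define \<delta> where "\<delta> = infdist w S"
  have ne: "S \<noteq> {}" using S(1) subspace_0 by blast
  have \<delta>0: "0 \<le> \<delta>" by (simp add: \<delta>_def infdist_nonneg)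
  have \<delta>le: "\<delta> \<le> norm (w - s)" if "s \<in> S" for s
    using infdist_le[OF that, of w] by (simp add: \<delta>_def dist_norm)
  have "\<exists>s\<in>S. (norm (w - s))\<^sup>2 < \<delta>\<^sup>2 + 1 / real (Suc n)" for n
  proof -
    have "\<delta> < sqrt (\<delta>\<^sup>2 + 1 / real (Suc n))"
      by (rule real_less_rsqrt) simp
    then have "Inf (dist w ` S) < sqrt (\<delta>\<^sup>2 + 1 / real (Suc n))"
      using ne by (simp add: \<delta>_def infdist_notempty)
    then obtain s where "s \<in> S" "norm (w - s) < sqrt (\<delta>\<^sup>2 + 1 / real (Suc n))"
      using ne cInf_lessD[of "dist w ` S"] by (auto simp: dist_norm)
    moreover from this(2) have "(norm (w - s))\<^sup>2 < (sqrt (\<delta>\<^sup>2 + 1 / real (Suc n)))\<^sup>2"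
      by (intro power_strict_mono) auto
    moreover have "0 \<le> \<delta>\<^sup>2 + 1 / real (Suc n)"
      by simp
    ultimately show ?thesis
      by (intro bexI[of _ s]) simp_all
  qed
  then obtain s where sS: "\<And>n. s n \<in> S"
    and sn: "\<And>n. (norm (w - s n))\<^sup>2 < \<delta>\<^sup>2 + 1 / real (Suc n)"
    by metis
  \<comment> \<open>The midpoint of \<open>s m\<close> and \<open>s n\<close> is at distance at
    least \<open>\<delta>\<close> from \<open>w\<close>, so the parallelogram identity leaves only
    the two excesses over \<open>\<delta>\<^sup>2\<close>, doubled.\<close>
  have par: "(norm (s m - s n))\<^sup>2 \<le> 2 / real (Suc m) + 2 / real (Suc n)" for m n
  proof -
    have "(1/2) *\<^sub>R (s m + s n) \<in> S"
      using S(1) sS by (simp add: subspace_add subspace_scale)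
    then have "\<delta>\<^sup>2 \<le> (norm (w - (1/2) *\<^sub>R (s m + s n)))\<^sup>2"
      by (intro power_mono \<delta>le \<delta>0)
    moreover have "(norm (s m - s n))\<^sup>2 + 4 * (norm (w - (1/2) *\<^sub>R (s m + s n)))\<^sup>2
        = 2 * (norm (w - s m))\<^sup>2 + 2 * (norm (w - s n))\<^sup>2"
      by (simp add: power2_norm_eq_inner inner_diff inner_add algebra_simps inner_commute)
    ultimately show ?thesis
      using sn[of m] sn[of n] by simp
  qed
  have "Cauchy s"
  proof (rule metric_CauchyI)
    fix e :: real assume "0 < e"
    \<comment> \<open>This threshold makes each of the two terms in \<open>par\<close> less than
      half of \<open>e\<^sup>2\<close>.\<close>
    then obtain N where N: "4 / e\<^sup>2 < real N"
      using reals_Archimedean2 by blast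
    have "dist (s m) (s n) < e" if "N \<le> m" "N \<le> n" for m n
    proof -
      have "2 / real (Suc k) < e\<^sup>2 / 2" if "N \<le> k" for k
      proof -
        have "4 / e\<^sup>2 < real (Suc k)" using N that by linarith
        then show ?thesis using \<open>0 < e\<close> by (simp add: field_simps)
      qed
      from this[OF that(1)] this[OF that(2)] have "(norm (s m - s n))\<^sup>2 < e\<^sup>2"
        using par[of m n] by linarith
      then show ?thesis
        using \<open>0 < e\<close> by (simp add: dist_norm power_less_imp_less_base)
    qed
    then show "\<exists>N. \<forall>m\<ge>N. \<forall>n\<ge>N. dist (s m) (s n) < e" by blast
  qed
  then obtain y where y: "s \<longlonglongrightarrow> y"
    using Cauchy_convergent convergent_def by blast
  have "y \<in> S"
    using closed_sequentially[OF S(2) _ y] sS by simp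
  have "(\<lambda>n. (norm (w - s n))\<^sup>2) \<longlonglongrightarrow> (norm (w - y))\<^sup>2"
    using y by (intro tendsto_power tendsto_norm tendsto_diff tendsto_const)
  moreover have "(\<lambda>n. \<delta>\<^sup>2 + 1 / real (Suc n)) \<longlonglongrightarrow> \<delta>\<^sup>2 + 0"
    by (intro tendsto_add tendsto_const LIMSEQ_Suc[OF lim_1_over_n])
  ultimately have "(norm (w - y))\<^sup>2 \<le> \<delta>\<^sup>2 + 0"
    by (rule LIMSEQ_le) (simp add: less_imp_le[OF sn] del: of_nat_Suc)
  then have "norm (w - y) \<le> \<delta>"
    using power2_le_imp_le[OF _ \<delta>0] by simp
  then have "norm (w - y) \<le> norm (w - s')" if "s' \<in> S" for s'
    using \<delta>le[OF that] by linarith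
  then show ?thesis
    using \<open>y \<in> S\<close> by blast
qed

text \<open>A nearest point works: were the residual not orthogonal to some \<open>s\<close> in
  \<open>S\<close>, a move along \<open>s\<close> would bring the point closer to
  \<open>w\<close>.\<close>

lemma orthogonal_decomposition:
  fixes S :: "'a::{real_inner, complete_space} set"
  assumes S: "subspace S" "closed S"
  obtains y where "y \<in> S" "w - y \<in> S\<^sup>\<bottom>"
proof -
  obtain y where y: "y \<in> S" and min: "\<And>s. s \<in> S \<Longrightarrow> norm (w - y) \<le> norm (w - s)"
    using subspace_nearest_point_exists[OF S] by blast
  have "inner (w - y) s = 0" if s: "s \<in> S" for s
  proof (rule ccontr)
    assume nz: "inner (w - y) s \<noteq> 0"
    then have pos: "0 < inner s s" by auto
    \<comment> \<open>The minimizer of the quadratic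
      \<open>t \<mapsto> (norm ((w - y) - t *\<^sub>R s))\<^sup>2\<close>.\<close>
    define t where "t = inner (w - y) s / inner s s"
    have "y + t *\<^sub>R s \<in> S"
      using S(1) y s by (simp add: subspace_add subspace_scale)
    from min[OF this] have "(norm (w - y))\<^sup>2 \<le> (norm ((w - y) - t *\<^sub>R s))\<^sup>2"
      by (simp add: algebra_simps)
    also have "\<dots> = (norm (w - y))\<^sup>2 - 2 * t * inner (w - y) s + t * t * inner s s"
      unfolding power2_norm_eq_inner inner_diff_left[of "w - y" "t *\<^sub>R s"] inner_diff_right[of _ "w - y" "t *\<^sub>R s"]
      by (simp add: inner_commute[of s "w - y"])
    also have "\<dots> = (norm (w - y))\<^sup>2 - (inner (w - y) s)\<^sup>2 / inner s s"
      using pos by (simp add: t_def power2_eq_square)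
    finally show False
      using nz pos by (simp add: divide_le_0_iff)
  qed
  then show ?thesis
    using y that by (auto simp: orthogonal_comp_iff)
qed

text \<open>Uniqueness holds because \<open>S\<close> meets its complement only in 0. This rule
  evaluates the definite description without unfolding it again.\<close>

lemma orth_proj_eqI:
  assumes "subspace S" "y \<in> S" "w - y \<in> S\<^sup>\<bottom>"
  shows "orth_proj S w = y"
  unfolding orth_proj_def
proof (rule the_equality)
  fix z assume z: "z \<in> S \<and> w - z \<in> S\<^sup>\<bottom>"
  have "z - y \<in> S" using z assms(1,2) by (simp add: subspace_diff)
  moreover have "z - y \<in> S\<^sup>\<bottom>"
    using subspace_diff[OF subspace_orthogonal_comp assms(3), of "w - z"] z by simp
  ultimately have "inner (z - y) (z - y) = 0"
    by (simp add: orthogonal_comp_iff)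
  then show "z = y" by simp
qed (use assms in simp)

lemma
  fixes S :: "'a::{real_inner, complete_space} set"
  assumes S: "subspace S" "closed S"
  shows orth_proj_in: "orth_proj S w \<in> S"
    and orth_proj_residual: "w - orth_proj S w \<in> S\<^sup>\<bottom>"
proof -
  obtain y where "y \<in> S" "w - y \<in> S\<^sup>\<bottom>"
    using orthogonal_decomposition[OF S] by blast
  moreover from this have "orth_proj S w = y"
    by (rule orth_proj_eqI[OF S(1)])
  ultimately show "orth_proj S w \<in> S" "w - orth_proj S w \<in> S\<^sup>\<bottom>"
    by auto
qed

text \<open>Linearity follows from uniqueness, since sums and multiples of residuals stay in the
  complement; the bound is Pythagoras. Boundedness is what allows \<open>onorm\<close> to be used
  for the operator that defines \<open>\<mu>\<close>.\<close>

lemma bounded_linear_orth_proj: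
  fixes S :: "'a::{real_inner, complete_space} set"
  assumes S: "subspace S" "closed S"
  shows "bounded_linear (orth_proj S)"
proof (rule bounded_linear_intro)
  note inS = orth_proj_in[OF S] and res = orth_proj_residual[OF S]
  show "orth_proj S (x + y) = orth_proj S x + orth_proj S y" for x y
    using subspace_add[OF subspace_orthogonal_comp res[of x] res[of y]]
    by (intro orth_proj_eqI S subspace_add inS) (simp add: algebra_simps)
  show "orth_proj S (c *\<^sub>R x) = c *\<^sub>R orth_proj S x" for c x
    using subspace_scale[OF subspace_orthogonal_comp res[of x], of c]
    by (intro orth_proj_eqI S subspace_scale inS) (simp add: algebra_simps)
  show "norm (orth_proj S x) \<le> norm x * 1" for x
  proof -
    have "inner (x - orth_proj S x) (orth_proj S x) = 0"
      using res inS by (auto simp: orthogonal_comp_iff)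
    then have "(norm x)\<^sup>2 = (norm (x - orth_proj S x))\<^sup>2 + (norm (orth_proj S x))\<^sup>2"
      by (simp add: power2_norm_eq_inner inner_diff inner_commute)
    then have "(norm (orth_proj S x))\<^sup>2 \<le> (norm x)\<^sup>2" by simp
    from power2_le_imp_le[OF this] show ?thesis by simp
  qed
qed

section \<open>Quasi-optimality of bounded projections\<close>

text \<open>The map \<open>w \<mapsto> w - P w\<close> vanishes on \<open>U\<close>, so any
  \<open>v\<close> in \<open>U\<close> may be subtracted from \<open>w\<close> before
  estimating.\<close>

lemma norm_diff_projection_le:
  assumes U: "U \<noteq> {}" and P: "bounded_linear P" and M: "onorm P \<le> M"
    and fix_U: "\<And>v. v \<in> U \<Longrightarrow> P v = v"
  shows "norm (w - P w) \<le> (1 + M) * best_error U w"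
proof -
  have M1: "0 < 1 + M"
    using onorm_pos_le[OF P] M by linarith
  \<comment> \<open>Dividing by the constant first turns the estimate into a lower bound for the set
    whose infimum is \<open>best_error U w\<close>.\<close>
  have "norm (w - P w) / (1 + M) \<le> norm (w - v)" if "v \<in> U" for v
  proof -
    have "w - P w = (w - v) - P (w - v)"
      using fix_U[OF that] by (simp add: linear_diff[OF bounded_linear.linear[OF P]])
    then have "norm (w - P w) \<le> norm (w - v) + norm (P (w - v))"
      by (metis norm_triangle_ineq4)
    also have "norm (P (w - v)) \<le> M * norm (w - v)"
      using onorm[OF P, of "w - v"] M by (meson mult_right_mono norm_ge_zero order_trans)
    finally show ?thesis
      using M1 by (simp add: field_simps)
  qed
  then have "norm (w - P w) / (1 + M) \<le> best_error U w"
    unfolding best_error_def using U by (intro cINF_greatest)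
  then show ?thesis
    using M1 by (simp add: field_simps)
qed

section \<open>Kernels, ranges and harmonic spaces of unbounded operators\<close>

lemma linear_operator_on_0: "linear_operator_on V d \<Longrightarrow> d 0 = 0"
  unfolding linear_operator_on_def using subspace_0[of V] by (metis scaleR_zero_left)

lemma linear_operator_on_diff:
  assumes "linear_operator_on V d" "u \<in> V" "v \<in> V"
  shows "d (u - v) = d u - d v"
proof -
  have "d (u + (-1) *\<^sub>R v) = d u + (-1) *\<^sub>R d v"
    using assms unfolding linear_operator_on_def by (metis subspace_scale)
  then show ?thesis by simp
qed

lemma linear_operator_on_subset:
  "linear_operator_on V d \<Longrightarrow> subspace U \<Longrightarrow> U \<subseteq> V \<Longrightarrow> linear_operator_on U d"
  unfolding linear_operator_on_def by blast

lemma subspace_op_kernel: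
  assumes d: "linear_operator_on V d" shows "subspace (op_kernel V d)"
  using d linear_operator_on_0[OF d]
  unfolding op_kernel_def linear_operator_on_def by (auto simp: subspace_def)

lemma subspace_op_range:
  assumes d: "linear_operator_on V d" shows "subspace (d ` V)"
proof (rule subspaceI)
  note V = d[unfolded linear_operator_on_def]
  have "0 \<in> V" using V subspace_0 by blast
  then show "0 \<in> d ` V"
    using linear_operator_on_0[OF d] by (metis image_eqI)
  fix x assume "x \<in> d ` V"
  then obtain u where u: "u \<in> V" "x = d u" by blast
  have "c *\<^sub>R u \<in> V" for c
    using V u(1) by (simp add: subspace_scale)
  then show "c *\<^sub>R x \<in> d ` V" for c
    using V u by (metis image_eqI)
  fix y assume "y \<in> d ` V"
  then obtain v where v: "v \<in> V" "y = d v" by blast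
  have "u + v \<in> V"
    using V u(1) v(1) by (simp add: subspace_add)
  then show "x + y \<in> d ` V"
    using V u v by (metis image_eqI)
qed

text \<open>The kernel is the preimage of the closed graph under the continuous map
  \<open>x \<mapsto> (x, 0)\<close>.\<close>

lemma closed_op_kernel:
  assumes "closed ((\<lambda>u. (u, d u)) ` V)"
  shows "closed (op_kernel V d)"
proof -
  have "op_kernel V d = (\<lambda>x. (x, 0)) -` ((\<lambda>u. (u, d u)) ` V)"
    by (auto simp: op_kernel_def)
  then show ?thesis
    using assms by (simp add: closed_vimage continuous_on_Pair)
qed

lemma subspace_harmonic: "linear_operator_on V d \<Longrightarrow> subspace (harmonic V d)"
  unfolding harmonic_def by (intro subspace_inter subspace_op_kernel subspace_orthogonal_comp)

lemma closed_harmonic: "closed (op_kernel V d) \<Longrightarrow> closed (harmonic V d)"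
  unfolding harmonic_def by (intro closed_Int closed_orthogonal_comp)

text \<open>Project \<open>z\<close> onto the closed range; the residual is still a cycle because
  the closed kernel contains that closure. The closure appears since the lemma also serves the
  discrete spaces, whose ranges are not shown to be closed.\<close>

lemma hodge_decomposition:
  fixes V :: "'a::{real_inner, complete_space} set"
  assumes d: "linear_operator_on V d" and cl: "closed (op_kernel V d)"
    and nil: "d ` V \<subseteq> op_kernel V d" and z: "z \<in> op_kernel V d"
  obtains b q where "b \<in> closure (d ` V)" "q \<in> harmonic V d" "z = b + q"
proof -
  obtain b where b: "b \<in> closure (d ` V)" "z - b \<in> (closure (d ` V))\<^sup>\<bottom>"
    using orthogonal_decomposition[OF subspace_closure[OF subspace_op_range[OF d]] closed_closure]
    by blast
  have "b \<in> op_kernel V d"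
    using closure_minimal[OF nil cl] b(1) by blast
  then have "z - b \<in> harmonic V d"
    using z b(2) subspace_diff[OF subspace_op_kernel[OF d]]
    by (simp add: harmonic_def orthogonal_comp_closure)
  then show ?thesis
    using that[OF b(1)] by simp
qed

section \<open>Testing with cycles, and the gap between harmonic spaces\<close>

lemma solves_hodge_dirac_test_kernel:
  assumes "solves_hodge_dirac U d f u p" "z \<in> op_kernel U d"
  shows "inner (d u) z + inner p z = inner f z"
  using assms unfolding solves_hodge_dirac_def op_kernel_def by force

text \<open>A discrete harmonic \<open>q\<close> is a cycle of \<open>V\<close>, so it differs from
  its harmonic part \<open>r\<close> by a boundary. Applying \<open>P\<close> to that boundary shows
  that \<open>q - P r\<close> is a discrete boundary, hence orthogonal to both \<open>q\<close> and
  \<open>r\<close>.\<close>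

lemma harmonic_gap:
  fixes V :: "'a::{real_inner, complete_space} set"
  assumes d: "linear_operator_on V d" and cl: "closed (op_kernel V d)"
    and nil: "d ` V \<subseteq> op_kernel V d" and cB: "closed (d ` V)"
    and U: "U \<subseteq> V" and P: "linear P" "range P = U" "\<And>v. v \<in> U \<Longrightarrow> P v = v"
    and comm: "\<And>v. v \<in> V \<Longrightarrow> P (d v) = d (P v)"
    and q: "q \<in> harmonic U d"
  defines "r \<equiv> orth_proj (harmonic V d) q"
  shows "q - r \<in> d ` V" and "norm (q - r) \<le> norm (r - P r)"
proof -
  have "q \<in> op_kernel V d"
    using q U by (auto simp: harmonic_def op_kernel_def)
  then obtain b h where b: "b \<in> d ` V" and h: "h \<in> harmonic V d" and q_eq: "q = b + h"
    using hodge_decomposition[OF d cl nil] cB by (metis closure_closed)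
  have "b \<in> (harmonic V d)\<^sup>\<bottom>"
    using b by (auto simp: harmonic_def orthogonal_comp_iff inner_commute)
  then have "r = h"
    unfolding r_def by (intro orth_proj_eqI subspace_harmonic d h) (simp add: q_eq)
  show qr: "q - r \<in> d ` V"
    using b by (simp add: q_eq \<open>r = h\<close>)
  then obtain v where v: "v \<in> V" "q - r = d v" by blast
  have "P q = q" using q P(3) by (auto simp: harmonic_def op_kernel_def)
  then have "q - P r = P (q - r)" using P(1) by (simp add: linear_diff)
  also have "\<dots> = d (P v)" using v comm by simp
  finally have qP: "q - P r \<in> d ` U" using P(2) by blast
  have "inner q (q - P r) = 0"
    using q qP by (auto simp: harmonic_def orthogonal_comp_iff)
  moreover have "inner r (q - P r) = 0"
    using h qP U by (auto simp: harmonic_def orthogonal_comp_iff \<open>r = h\<close>)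
  \<comment> \<open>Since \<open>q - r\<close> is orthogonal to \<open>q - P r\<close>, the second
    factor \<open>q - r\<close> may be replaced by \<open>P r - r\<close>.\<close>
  ultimately have "(norm (q - r))\<^sup>2 = inner (q - r) (P r - r)"
    unfolding power2_norm_eq_inner by (simp add: inner_diff inner_commute)
  also have "\<dots> \<le> norm (q - r) * norm (r - P r)"
    by (metis norm_cauchy_schwarz norm_minus_commute)
  finally show "norm (q - r) \<le> norm (r - P r)"
    by (cases "norm (q - r) = 0") (auto simp: power2_eq_square)
qed

section \<open>Error estimate for the harmonic component\<close>

theorem theorem3p9:
  fixes V :: "'a::{real_inner, complete_space} set"
    and d :: "'a \<Rightarrow> 'a"
    and Vh :: "'h \<Rightarrow> 'a set"
    and \<pi> :: "'h \<Rightarrow> 'a \<Rightarrow> 'a"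
  assumes "diffuse_fredholm_nilpotent V d"
    and "\<And>h. subspace (Vh h)" and "\<And>h. closed (Vh h)" and "\<And>h. Vh h \<subseteq> V"
    and "\<And>h. d ` Vh h \<subseteq> Vh h"
    and "\<And>h. projection_onto (Vh h) (\<pi> h)"
    and "\<And>h. bounded_linear (\<pi> h)" and "\<exists>M. \<forall>h. onorm (\<pi> h) \<le> M"
    and "\<And>h v. v \<in> V \<Longrightarrow> \<pi> h (d v) = d (\<pi> h v)"
  shows "\<exists>C>0. \<forall>f h u p u\<^sub>h p\<^sub>h.
           solves_hodge_dirac V d f u p \<longrightarrow>
           solves_hodge_dirac (Vh h) d f u\<^sub>h p\<^sub>h \<longrightarrow>
           (let \<mu> = onorm (\<lambda>w. orth_proj (harmonic V d) w - \<pi> h (orth_proj (harmonic V d) w))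
            in norm (p - p\<^sub>h) \<le> C * (best_error (Vh h) p + \<mu> * best_error (Vh h) (d u)))"
proof -
  have d: "linear_operator_on V d" and graph: "closed ((\<lambda>u. (u, d u)) ` V)"
    and nil: "d ` V \<subseteq> op_kernel V d" and cB: "closed (d ` V)"
    using assms(1) unfolding diffuse_fredholm_nilpotent_def nilpotent_operator_def
      closed_densely_defined_def by auto
  have cl: "closed (op_kernel V d)"
    using graph by (rule closed_op_kernel)
  obtain M where M: "\<And>h. onorm (\<pi> h) \<le> M" using assms(8) by blast
  \<comment> \<open>Any index will do here: \<open>undefined\<close> supplies one, and operator
    norms are nonnegative.\<close>
  have M1: "0 < 1 + M"
    using onorm_pos_le[OF assms(7)[of undefined]] M[of undefined] by linarith
  define P where "P = orth_proj (harmonic V d)"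
  have blP: "bounded_linear P"
    unfolding P_def by (intro bounded_linear_orth_proj subspace_harmonic closed_harmonic d cl)
  have main: "norm (p - p\<^sub>h) \<le> 2 * (1 + M) * (best_error (Vh h) p
      + onorm (\<lambda>w. P w - \<pi> h (P w)) * best_error (Vh h) (d u))"
    if sol: "solves_hodge_dirac V d f u p" and sol\<^sub>h: "solves_hodge_dirac (Vh h) d f u\<^sub>h p\<^sub>h"
    for f h u p u\<^sub>h p\<^sub>h
  proof -
    let ?U = "Vh h"
    define \<mu> where "\<mu> = onorm (\<lambda>w. P w - \<pi> h (P w))"
    have bl\<mu>: "bounded_linear (\<lambda>w. P w - \<pi> h (P w))"
      by (intro bounded_linear_sub blP bounded_linear_compose[OF assms(7)])
    have lin: "linear (\<pi> h)" and ran: "range (\<pi> h) = ?U"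
      and fix_U: "\<And>v. v \<in> ?U \<Longrightarrow> \<pi> h v = v"
      using assms(6)[of h] unfolding projection_onto_def by (blast, blast, metis rangeE)
    have dU: "linear_operator_on ?U d"
      using linear_operator_on_subset[OF d assms(2,4)] .
    have ker_U: "op_kernel ?U d = op_kernel V d \<inter> ?U"
      using assms(4)[of h] by (auto simp: op_kernel_def)
    have clU: "closed (op_kernel ?U d)"
      unfolding ker_U using cl assms(3) by blast
    have nilU: "d ` ?U \<subseteq> op_kernel ?U d"
      unfolding ker_U using nil assms(4,5)[of h] by blast
    have u: "u \<in> V" and p: "p \<in> harmonic V d"
      using sol by (auto simp: solves_hodge_dirac_def)
    have u\<^sub>h: "u\<^sub>h \<in> ?U" and p\<^sub>h: "p\<^sub>h \<in> harmonic ?U d"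
      using sol\<^sub>h by (auto simp: solves_hodge_dirac_def)
    have approx: "norm (w - \<pi> h w) \<le> (1 + M) * best_error ?U w" for w
      using subspace_0[OF assms(2)[of h]]
      by (intro norm_diff_projection_le assms(7) M fix_U) auto

    \<comment> \<open>Commutation makes the projection of a cycle a discrete cycle, to which the
      discrete Hodge decomposition applies.\<close>
    have "\<pi> h p \<in> op_kernel ?U d"
      using p assms(9)[of p h] ran linear_0[OF lin] by (auto simp: harmonic_def op_kernel_def)
    then obtain c q where c: "c \<in> closure (d ` ?U)" and q: "q \<in> harmonic ?U d"
      and \<pi>p: "\<pi> h p = c + q"
      using hodge_decomposition[OF dU clU nilU] by metis
    \<comment> \<open>Discrete boundaries are boundaries, so \<open>p\<close> as well as
      \<open>q\<close> is orthogonal to \<open>c\<close>. Pythagoras then makes the discrete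
      harmonic \<open>q\<close> at least as close to \<open>p\<close> as \<open>\<pi> h p\<close>
      is.\<close>
    have "p \<in> (closure (d ` ?U))\<^sup>\<bottom>" "q \<in> (closure (d ` ?U))\<^sup>\<bottom>"
      using p q orthogonal_comp_anti_mono[of "d ` ?U" "d ` V"] assms(4)[of h]
      by (auto simp: harmonic_def orthogonal_comp_closure)
    then have "inner p c = 0" "inner q c = 0"
      using c by (auto simp: orthogonal_comp_iff)
    then have "(norm (p - \<pi> h p))\<^sup>2 = (norm (p - q))\<^sup>2 + (norm c)\<^sup>2"
      by (simp add: \<pi>p power2_norm_eq_inner inner_diff inner_add inner_commute)
    then have "(norm (p - q))\<^sup>2 \<le> (norm (p - \<pi> h p))\<^sup>2" by simp
    from power2_le_imp_le[OF this] have pq: "norm (p - q) \<le> (1 + M) * best_error ?U p"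
      using approx[of p] by simp

    define g where "g = q - p\<^sub>h"
    have g: "g \<in> harmonic ?U d"
      unfolding g_def using subspace_diff[OF subspace_harmonic[OF dU]] q p\<^sub>h by blast
    have gperp: "inner (d v) g = 0" if "v \<in> ?U" for v
      using g that by (auto simp: harmonic_def orthogonal_comp_iff inner_commute)
    have gU: "g \<in> op_kernel ?U d" and gV: "g \<in> op_kernel V d"
      using g ker_U by (auto simp: harmonic_def)
    \<comment> \<open>The vector \<open>g\<close> is a cycle for both problems, so \<open>f\<close>
      cancels; the term with \<open>d u\<^sub>h\<close> vanishes because \<open>g\<close> is
      orthogonal to discrete boundaries.\<close>
    have orth: "inner p\<^sub>h g = inner (d u) g + inner p g"
      using solves_hodge_dirac_test_kernel[OF sol gV] solves_hodge_dirac_test_kernel[OF sol\<^sub>h gU]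
        gperp[OF u\<^sub>h] by simp

    define w where "w = d u - \<pi> h (d u)"
    note gap = harmonic_gap[OF d cl nil cB assms(4) lin ran fix_U assms(9) g, folded P_def]
    have \<pi>u: "\<pi> h u \<in> ?U" using ran by blast
    then have "w = d (u - \<pi> h u)"
      using assms(4)[of h] by (auto simp: w_def assms(9) u linear_operator_on_diff[OF d u])
    moreover have "u - \<pi> h u \<in> V"
      using d u \<pi>u assms(4)[of h] unfolding linear_operator_on_def by (blast intro: subspace_diff)
    ultimately have wB: "w \<in> d ` V" by blast
    have "P g \<in> harmonic V d"
      unfolding P_def by (intro orth_proj_in subspace_harmonic closed_harmonic d cl)
    then have "inner w (P g) = 0"
      using wB by (auto simp: harmonic_def orthogonal_comp_iff inner_commute)
    \<comment> \<open>Two replacements at no cost: \<open>\<pi> h (d u) = d (\<pi> h u)\<close> is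
      orthogonal to \<open>g\<close>, and the boundary \<open>w\<close> is orthogonal to
      \<open>P g\<close>.\<close>
    then have "inner (d u) g = inner w (g - P g)"
      using gperp[OF \<pi>u] by (simp add: w_def assms(9) u inner_diff)
    then have "\<bar>inner (d u) g\<bar> \<le> norm w * norm (g - P g)"
      by (simp add: Cauchy_Schwarz_ineq2)
    \<comment> \<open>By the gap bound, \<open>g - P g\<close> is no longer than
      \<open>P g - \<pi> h (P g)\<close>, whose norm is at most
      \<open>\<mu> * norm g\<close>.\<close>
    also have "\<dots> \<le> norm w * (\<mu> * norm g)"
      using order_trans[OF gap(2) onorm[OF bl\<mu>, of g]] unfolding \<mu>_def
      by (simp add: mult_left_mono)
    also have "\<dots> \<le> (1 + M) * best_error ?U (d u) * (\<mu> * norm g)"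
      using approx[of "d u"] onorm_pos_le[OF bl\<mu>] unfolding w_def \<mu>_def
      by (intro mult_right_mono) auto
    finally have du: "\<bar>inner (d u) g\<bar> \<le> (1 + M) * best_error ?U (d u) * \<mu> * norm g"
      by (simp add: mult_ac)

    \<comment> \<open>Split \<open>g\<close> as \<open>(q - p) + (p - p\<^sub>h)\<close>; by
      \<open>orth\<close> the second summand contributes \<open>- inner (d u) g\<close>.\<close>
    have "(norm g)\<^sup>2 = inner (q - p) g - inner (d u) g"
      using orth by (simp add: g_def power2_norm_eq_inner inner_diff algebra_simps)
    also have "\<dots> \<le> norm (p - q) * norm g + (1 + M) * best_error ?U (d u) * \<mu> * norm g"
      using du norm_cauchy_schwarz[of "q - p" g] by (simp add: norm_minus_commute)
    also have "\<dots> \<le> ((1 + M) * best_error ?U p + (1 + M) * best_error ?U (d u) * \<mu>) * norm g"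
      using mult_right_mono[OF pq norm_ge_zero[of g]] by (simp add: algebra_simps)
    finally have "norm g * norm g
        \<le> ((1 + M) * best_error ?U p + (1 + M) * best_error ?U (d u) * \<mu>) * norm g"
      by (simp add: power2_eq_square)
    \<comment> \<open>Signs are needed to cancel \<open>norm g\<close> also when
      \<open>g = 0\<close>, and to enlarge the factor of the second term below to 2.\<close>
    moreover have nonneg: "0 \<le> (1 + M) * best_error ?U p" "0 \<le> (1 + M) * best_error ?U (d u) * \<mu>"
      using approx[of p] approx[of "d u"] onorm_pos_le[OF bl\<mu>] unfolding \<mu>_def
      by (meson norm_ge_zero order_trans mult_nonneg_nonneg)+
    ultimately have "norm g \<le> (1 + M) * best_error ?U p + (1 + M) * best_error ?U (d u) * \<mu>"
      by (cases "g = 0") auto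
    moreover have "norm (p - p\<^sub>h) \<le> norm (p - q) + norm g"
      using norm_triangle_ineq[of "p - q" g] by (simp add: g_def)
    \<comment> \<open>The error of \<open>p\<close> enters twice, through \<open>p - q\<close> and
      through \<open>g\<close>, which is the source of the factor 2.\<close>
    ultimately have "norm (p - p\<^sub>h)
        \<le> 2 * ((1 + M) * best_error ?U p) + 2 * ((1 + M) * best_error ?U (d u) * \<mu>)"
      using pq nonneg by linarith
    then show ?thesis
      unfolding \<mu>_def by (simp add: algebra_simps)
  qed
  show ?thesis
    using M1 main unfolding Let_def P_def by (intro exI[of _ "2 * (1 + M)"]) auto
qed

end
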